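(* Let $F\subset\mathbb{T}$ be a closed subset of zero measure and let $L_F$ be the corresponding Hermitian, unbounded and densely defined operator in the Hardy space $\mathscr{H}_2$, namely the restriction of $H=z\frac{d}{dz}$ to $\{f\in\mathscr{D}(H): f=0\text{ on }F\}$. Then each of the two defect spaces $\mathscr{D}_\pm(L_F)=\{f_\pm\in\mathscr{D}(L_F^* ):L_F^*f_\pm=\pm i f_\pm\}$ is a reproducing kernel Hilbert space (RKHS) with reproducing kernel equal to the Hurwitz zeta function $$Z(\alpha-\beta)=\sum_{n=0}^\infty\frac{e(n(\alpha-\beta))}{1+n^2}.$$
   Context: $\mathbb{D}$ is the open unit disk in $\mathbb{C}$, $\mathbb{T}=\partial\mathbb{D}$, $e(x)=e^{i2\pi x}$; a point $e(\theta)\in\mathbb{T}$ is identified with its angular variable $\theta\in\mathbb{R}/\mathbb{Z}$. $\mathscr{H}_2$ is the Hardy space of analytic functions $f(z)=\sum_{k\ge0}x_kz^k$ on $\mathbb{D}$ with $\|f\|^2=\sum|x_k|^2<\infty$. $H=z\frac{d}{dz}$ is the selfadjoint operator with domain $\mathscr{D}(H)=\{f\in\mathscr{H}_2: z\frac{d}{dz}f\in\mathscr{H}_2\}$. For $f\in\mathscr{D}(H)$ the Taylor coefficients are absolutely summable, so $f$ extends continuously to $\overline{\mathbb{D}}$, and "$f=0$ on $F$" refers to this extension. $L_F^*$ is the adjoint of $L_F$ in $\mathscr{H}_2$, with domain $\mathscr{D}(L_F^* )$. The function $Z(x)=\sum_{n=0}^\infty\frac{e(nx)}{1+n^2}$ is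 what the paper calls the Hurwitz zeta function; the kernel is $K(\alpha,\beta)=Z(\alpha-\beta)$, $(\alpha,\beta)\in F\times F$. For a positive definite kernel $K$ on $F\times F$, the RKHS $\mathscr{H}(K)$ is the completion of the finitely supported functions $\varphi:F\to\mathbb{C}$ in the pre-Hilbert inner product $\langle\varphi,\psi\rangle_{\mathscr{H}(K)}=\sum_\alpha\sum_\beta\overline{\varphi(\alpha)}\psi(\beta)K(\alpha,\beta)$. *)

theory Defs
  imports "HOL-Complex_Analysis.Complex_Analysis"
begin

section \<open>The Hardy space of the unit disk\<close>

definition tcoeff :: "(complex \<Rightarrow> complex) \<Rightarrow> nat \<Rightarrow> complex" where
  "tcoeff f k = fps_nth (fps_expansion f 0) k"

text \<open>
  Elements are analytic functions on the open disk. They are set to 0 off the disk, so that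
  equality of HOL functions is equality on the disk.
\<close>

definition hardy2 :: "(complex \<Rightarrow> complex) set" where
  "hardy2 = {f. f holomorphic_on ball 0 1 \<and> (\<forall>z. z \<notin> ball 0 1 \<longrightarrow> f z = 0)
                \<and> summable (\<lambda>k. (cmod (tcoeff f k))\<^sup>2)}"

text \<open>The inner product is conjugate-linear in the first argument.\<close>

definition hinner :: "(complex \<Rightarrow> complex) \<Rightarrow> (complex \<Rightarrow> complex) \<Rightarrow> complex" where
  "hinner f g = (\<Sum>k. cnj (tcoeff f k) * tcoeff g k)"

definition hnorm :: "(complex \<Rightarrow> complex) \<Rightarrow> real" where
  "hnorm f = sqrt (\<Sum>k. (cmod (tcoeff f k))\<^sup>2)"

definition hdense :: "(complex \<Rightarrow> complex) set \<Rightarrow> (complex \<Rightarrow> complex) set \<Rightarrow> bool" where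
  "hdense A V \<longleftrightarrow> (\<forall>f\<in>V. \<forall>\<epsilon>>0. \<exists>g\<in>A. hnorm (\<lambda>z. f z - g z) < \<epsilon>)"

text \<open>A subspace that is complete in the norm, i.e. a Hilbert space in its own right.\<close>

definition hilbert_subspace :: "(complex \<Rightarrow> complex) set \<Rightarrow> bool" where
  "hilbert_subspace V \<longleftrightarrow>
     V \<subseteq> hardy2 \<and> (\<lambda>z. 0) \<in> V
     \<and> (\<forall>f\<in>V. \<forall>g\<in>V. (\<lambda>z. f z + g z) \<in> V)
     \<and> (\<forall>c. \<forall>f\<in>V. (\<lambda>z. c * f z) \<in> V)
     \<and> (\<forall>s. (\<forall>n. s n \<in> V)
           \<and> (\<forall>\<epsilon>>0. \<exists>N. \<forall>m\<ge>N. \<forall>n\<ge>N. hnorm (\<lambda>z. s m z - s n z) < \<epsilon>)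
         \<longrightarrow> (\<exists>f\<in>V. (\<lambda>n. hnorm (\<lambda>z. s n z - f z)) \<longlonglongrightarrow> 0))"


section \<open>Unbounded operators, adjoints and defect spaces\<close>

definition opH :: "(complex \<Rightarrow> complex) \<Rightarrow> complex \<Rightarrow> complex" where
  "opH f = (\<lambda>z. if z \<in> ball 0 1 then z * deriv f z else 0)"

definition dom_H :: "(complex \<Rightarrow> complex) set" where
  "dom_H = {f \<in> hardy2. opH f \<in> hardy2}"

text \<open>
  A function in \<open>dom_H\<close> extends continuously to the closed disk; its value at a boundary point is
  therefore its limit there from inside the disk.
\<close>

definition dom_L :: "complex set \<Rightarrow> (complex \<Rightarrow> complex) set" where
  "dom_L F = {f \<in> dom_H. \<forall>\<zeta>\<in>F. (f \<longlongrightarrow> 0) (at \<zeta> within ball 0 1)}"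

text \<open>
  Operators are given by their graphs, and so is the adjoint. If the domain of an operator is
  dense, the adjoint graph is single-valued (\<open>adjoint_single_valued\<close> below) and is the graph of
  the usual adjoint operator. The domain of \<open>L\<^sub>F\<close> need not be dense for every closed null set \<open>F\<close>: a
  function in \<open>dom_H\<close> is Hoelder-1/2 up to the boundary, so the domain is \<open>{0}\<close> unless \<open>F\<close> is a
  Carleson set.
\<close>

type_synonym hop = "((complex \<Rightarrow> complex) \<times> (complex \<Rightarrow> complex)) set"

definition opL :: "complex set \<Rightarrow> hop" where
  "opL F = {(f, opH f) | f. f \<in> dom_L F}"

definition adjoint :: "hop \<Rightarrow> hop" where
  "adjoint G = {(g, h). g \<in> hardy2 \<and> h \<in> hardy2 \<and> (\<forall>(u, v)\<in>G. hinner v g = hinner u h)}"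

text \<open>The kernel of \<open>L\<^sub>F\<^sup>* - c\<close>; the defect spaces are the cases \<open>c = \<i>\<close> and \<open>c = -\<i>\<close>.\<close>

definition defect_space :: "complex \<Rightarrow> complex set \<Rightarrow> (complex \<Rightarrow> complex) set" where
  "defect_space c F =
     {f. f \<in> Domain (adjoint (opL F)) \<and> (f, \<lambda>z. c * f z) \<in> adjoint (opL F)}"

lemma tcoeff_diff:
  assumes "f holomorphic_on ball 0 1" "g holomorphic_on ball 0 1"
  shows "tcoeff (\<lambda>z. f z - g z) k = tcoeff f k - tcoeff g k"
  using higher_deriv_diff[OF assms, of 0 k]
  by (simp add: tcoeff_def fps_expansion_def diff_divide_distrib)

lemma hardy2_eqI:
  assumes "f \<in> hardy2" "g \<in> hardy2" "\<And>k. tcoeff f k = tcoeff g k"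
  shows "f = g"
proof
  fix z
  show "f z = g z"
  proof (cases "z \<in> ball 0 1")
    case True
    have "(\<lambda>n. tcoeff f n * z ^ n) sums f z" "(\<lambda>n. tcoeff g n * z ^ n) sums g z"
      using assms(1,2) True holomorphic_power_series[of _ 0 1 z]
      by (auto simp: hardy2_def tcoeff_def fps_expansion_def)
    then show ?thesis using assms(3) by (metis (no_types, lifting) ext sums_unique2)
  next
    case False
    then show ?thesis using assms by (auto simp: hardy2_def)
  qed
qed

lemma l2_mult_summable:
  fixes a b :: "nat \<Rightarrow> complex"
  assumes "summable (\<lambda>k. (cmod (a k))\<^sup>2)" "summable (\<lambda>k. (cmod (b k))\<^sup>2)"
  shows "summable (\<lambda>k. cnj (a k) * b k)"
proof (rule summable_norm_cancel, rule summable_comparison_test')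
  show "summable (\<lambda>k. (cmod (a k))\<^sup>2 + (cmod (b k))\<^sup>2)" by (intro summable_add assms)
  show "norm (norm (cnj (a k) * b k)) \<le> (cmod (a k))\<^sup>2 + (cmod (b k))\<^sup>2" if "0 \<le> k" for k
    using sum_squares_bound[of "cmod (a k)" "cmod (b k)"]
      mult_nonneg_nonneg[OF norm_ge_zero[of "a k"] norm_ge_zero[of "b k"]]
    by (simp add: norm_mult del: zero_le_mult_iff mult_nonneg_nonneg)
qed

lemma l2_diff_summable:
  fixes a b :: "nat \<Rightarrow> complex"
  assumes "summable (\<lambda>k. (cmod (a k))\<^sup>2)" "summable (\<lambda>k. (cmod (b k))\<^sup>2)"
  shows "summable (\<lambda>k. (cmod (a k - b k))\<^sup>2)"
proof (rule summable_comparison_test')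
  show "summable (\<lambda>k. 2 * (cmod (a k))\<^sup>2 + 2 * (cmod (b k))\<^sup>2)"
    by (intro summable_add summable_mult assms)
  show "norm ((cmod (a k - b k))\<^sup>2) \<le> 2 * (cmod (a k))\<^sup>2 + 2 * (cmod (b k))\<^sup>2" if "0 \<le> k" for k
  proof -
    have "(cmod (a k - b k))\<^sup>2 \<le> (cmod (a k) + cmod (b k))\<^sup>2"
      by (intro power_mono norm_triangle_ineq4) auto
    also have "\<dots> \<le> 2 * (cmod (a k))\<^sup>2 + 2 * (cmod (b k))\<^sup>2"
      using sum_squares_bound[of "cmod (a k)" "cmod (b k)"] by (simp add: power2_sum)
    finally show ?thesis by simp
  qed
qed

lemma adjoint_single_valued:
  assumes dom: "Domain G \<subseteq> hardy2" and dense: "hdense (Domain G) hardy2"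
  shows "single_valued (adjoint G)"
proof (rule single_valuedI)
  fix g h h' assume "(g, h) \<in> adjoint G" "(g, h') \<in> adjoint G"
  then have h: "h \<in> hardy2" "h' \<in> hardy2"
    and eq: "\<And>u. u \<in> Domain G \<Longrightarrow> hinner u h = hinner u h'"
    by (fastforce simp: adjoint_def)+
  define d where "d = (\<lambda>z. h z - h' z)"
  have td: "tcoeff d k = tcoeff h k - tcoeff h' k" for k
    using h tcoeff_diff[of h h' k] by (simp add: d_def hardy2_def)
  have sd: "summable (\<lambda>k. (cmod (tcoeff d k))\<^sup>2)"
    unfolding td using h by (intro l2_diff_summable) (auto simp: hardy2_def)
  have d: "d \<in> hardy2"
    using h sd by (auto simp: hardy2_def d_def intro!: holomorphic_intros)
  define D where "D = (\<Sum>k. (cmod (tcoeff d k))\<^sup>2)"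
  have small: "D < \<epsilon>\<^sup>2" if "\<epsilon> > 0" for \<epsilon> :: real
  proof -
    obtain u where u: "u \<in> Domain G" "hnorm (\<lambda>z. d z - u z) < \<epsilon>"
      using dense d \<open>\<epsilon> > 0\<close> unfolding hdense_def by blast
    have uh: "u \<in> hardy2" using u dom by auto
    have tdu: "tcoeff (\<lambda>z. d z - u z) k = tcoeff d k - tcoeff u k" for k
      using d uh tcoeff_diff[of d u k] by (simp add: hardy2_def)
    have su: "summable (\<lambda>k. (cmod (tcoeff u k))\<^sup>2)" "summable (\<lambda>k. (cmod (tcoeff h k))\<^sup>2)"
      "summable (\<lambda>k. (cmod (tcoeff h' k))\<^sup>2)"
      using uh h by (auto simp: hardy2_def)
    have sdu: "summable (\<lambda>k. (cmod (tcoeff d k - tcoeff u k))\<^sup>2)"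
      by (intro l2_diff_summable sd su)
    have "(\<Sum>k. cnj (tcoeff u k) * tcoeff d k) = hinner u h - hinner u h'"
      unfolding hinner_def td
      using suminf_diff[OF l2_mult_summable[OF su(1,2)] l2_mult_summable[OF su(1,3)]]
      by (simp add: right_diff_distrib)
    then have zero: "(\<Sum>k. cnj (tcoeff u k) * tcoeff d k) = 0" using eq u by simp
    have "(\<lambda>k. Re (cnj (tcoeff u k) * tcoeff d k)) sums 0"
      using summable_sums[OF l2_mult_summable[OF su(1) sd]] zero sums_Re by fastforce
    moreover have "(\<lambda>k. (cmod (tcoeff d k))\<^sup>2) sums D" unfolding D_def using sd by auto
    ultimately have "(\<lambda>k. (cmod (tcoeff d k))\<^sup>2 - Re (cnj (tcoeff u k) * tcoeff d k)) sums D"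
      using sums_diff by fastforce
    moreover have "(\<lambda>k. ((cmod (tcoeff d k - tcoeff u k))\<^sup>2 + (cmod (tcoeff d k))\<^sup>2) / 2) sums
        (((\<Sum>k. (cmod (tcoeff d k - tcoeff u k))\<^sup>2) + D) / 2)"
      unfolding D_def using sdu sd by (intro sums_divide sums_add) auto
    moreover have "(cmod y)\<^sup>2 - Re (cnj x * y) \<le> ((cmod (y - x))\<^sup>2 + (cmod y)\<^sup>2) / 2" for x y
    proof -
      have "0 \<le> (Re x)\<^sup>2 + (Im x)\<^sup>2" by simp
      then show ?thesis
        by (simp add: cmod_power2) (simp add: power2_eq_square algebra_simps)
    qed
    ultimately have "D \<le> ((\<Sum>k. (cmod (tcoeff d k - tcoeff u k))\<^sup>2) + D) / 2"
      by (rule sums_le[rotated 1])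
    then have "D \<le> (hnorm (\<lambda>z. d z - u z))\<^sup>2"
      unfolding hnorm_def tdu by (simp add: suminf_nonneg[OF sdu])
    also have "\<dots> < \<epsilon>\<^sup>2"
      using u(2) by (intro power_strict_mono) (auto simp: hnorm_def tdu suminf_nonneg[OF sdu])
    finally show ?thesis .
  qed
  have "D \<le> 0"
  proof (rule ccontr)
    assume "\<not> D \<le> 0"
    then show False using small[of "sqrt D"] by simp
  qed
  moreover have "0 \<le> D" unfolding D_def by (intro suminf_nonneg sd) auto
  ultimately have "\<forall>k. (cmod (tcoeff d k))\<^sup>2 = 0"
    using suminf_eq_zero_iff[OF sd] by (simp add: D_def)
  then show "h = h'" using h td by (intro hardy2_eqI) auto
qed


section \<open>The kernel and its reproducing kernel Hilbert space\<close>

definition e :: "real \<Rightarrow> complex" where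
  "e x = exp (\<i> * 2 * complex_of_real pi * complex_of_real x)"

text \<open>Any other representative of the angular variable modulo 1 would do.\<close>

definition angle :: "complex \<Rightarrow> real" where
  "angle \<zeta> = Arg2pi \<zeta> / (2 * pi)"

definition zero_measure :: "complex set \<Rightarrow> bool" where
  "zero_measure F \<longleftrightarrow> {x::real. e x \<in> F} \<in> null_sets lebesgue"

definition Z :: "real \<Rightarrow> complex" where
  "Z x = (\<Sum>n. e (real n * x) / (1 + (of_nat n)\<^sup>2))"

definition Z_kernel :: "complex \<Rightarrow> complex \<Rightarrow> complex" where
  "Z_kernel \<zeta> \<omega> = Z (angle \<zeta> - angle \<omega>)"

definition fin_supp :: "complex set \<Rightarrow> (complex \<Rightarrow> complex) set" where
  "fin_supp F = {\<phi>. finite {\<zeta>. \<phi> \<zeta> \<noteq> 0} \<and> {\<zeta>. \<phi> \<zeta> \<noteq> 0} \<subseteq> F}"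

definition kernel_inner ::
  "(complex \<Rightarrow> complex \<Rightarrow> complex) \<Rightarrow> (complex \<Rightarrow> complex) \<Rightarrow> (complex \<Rightarrow> complex) \<Rightarrow> complex" where
  "kernel_inner K \<phi> \<psi> =
     (\<Sum>\<alpha>\<in>{\<zeta>. \<phi> \<zeta> \<noteq> 0}. \<Sum>\<beta>\<in>{\<zeta>. \<psi> \<zeta> \<noteq> 0}. cnj (\<phi> \<alpha>) * \<psi> \<beta> * K \<alpha> \<beta>)"

definition positive_definite_kernel ::
  "complex set \<Rightarrow> (complex \<Rightarrow> complex \<Rightarrow> complex) \<Rightarrow> bool" where
  "positive_definite_kernel F K \<longleftrightarrow>
     (\<forall>\<phi>\<in>fin_supp F. Im (kernel_inner K \<phi> \<phi>) = 0 \<and> 0 \<le> Re (kernel_inner K \<phi> \<phi>))"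

text \<open>
  \<open>V\<close> is the completion \<open>\<H>(K)\<close> of the finitely supported functions on \<open>F\<close> in the inner product
  of \<open>K\<close>, by way of the isometry \<open>J\<close>: \<open>J\<close> is linear, preserves inner products, and maps onto a
  dense subspace of the Hilbert space \<open>V\<close>.
\<close>

definition RKHS_completion ::
  "complex set \<Rightarrow> (complex \<Rightarrow> complex \<Rightarrow> complex) \<Rightarrow> (complex \<Rightarrow> complex) set
    \<Rightarrow> ((complex \<Rightarrow> complex) \<Rightarrow> (complex \<Rightarrow> complex)) \<Rightarrow> bool" where
  "RKHS_completion F K V J \<longleftrightarrow>
     positive_definite_kernel F K \<and> hilbert_subspace V
     \<and> J ` fin_supp F \<subseteq> V
     \<and> (\<forall>\<phi>\<in>fin_supp F. \<forall>\<psi>\<in>fin_supp F. J (\<lambda>\<zeta>. \<phi> \<zeta> + \<psi> \<zeta>) = (\<lambda>z. J \<phi> z + J \<psi> z))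
     \<and> (\<forall>c. \<forall>\<phi>\<in>fin_supp F. J (\<lambda>\<zeta>. c * \<phi> \<zeta>) = (\<lambda>z. c * J \<phi> z))
     \<and> (\<forall>\<phi>\<in>fin_supp F. \<forall>\<psi>\<in>fin_supp F. hinner (J \<phi>) (J \<psi>) = kernel_inner K \<phi> \<psi>)
     \<and> hdense (J ` fin_supp F) V"

text \<open>
  An abstract isometry of \<open>\<H>(K)\<close> onto a defect space would say no more than that their dimensions
  agree, so the isometry is fixed. It sends the unit mass at \<open>\<alpha>\<close> to the vector below, which
  represents evaluation at \<open>\<alpha>\<close> on \<open>dom_H\<close>: formally,
  \<open>\<langle>kernel_vector c \<alpha>, (H - cnj c) u\<rangle> = \<Sum>n. u\<^sub>n e(n \<alpha>) = u(e(\<alpha>))\<close>.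
\<close>

definition kernel_vector :: "complex \<Rightarrow> complex \<Rightarrow> complex \<Rightarrow> complex" where
  "kernel_vector c \<alpha> =
     (\<lambda>z. if z \<in> ball 0 1 then \<Sum>n. e (- (real n * angle \<alpha>)) / (of_nat n - c) * z ^ n else 0)"

definition kernel_isometry :: "complex \<Rightarrow> (complex \<Rightarrow> complex) \<Rightarrow> complex \<Rightarrow> complex" where
  "kernel_isometry c \<phi> = (\<lambda>z. \<Sum>\<alpha>\<in>{\<zeta>. \<phi> \<zeta> \<noteq> 0}. \<phi> \<alpha> * kernel_vector c \<alpha> z)"

end

theory Submission
  imports Defs
begin

text \<open>
  Fix \<open>c = \<i>\<close> or \<open>c = -\<i>\<close> and write \<open>k\<^sub>\<alpha>\<close> for \<open>kernel_vector c \<alpha>\<close>. On Taylor coefficients \<open>H\<close> is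
  multiplication by \<open>n\<close>, so \<open>H - cnj c\<close> is multiplication by \<open>n - cnj c\<close>, where
  \<open>\<bar>n - cnj c\<bar>\<^sup>2 = 1 + n\<^sup>2\<close>. This has two consequences. First, \<open>H - cnj c\<close> maps \<open>dom_H\<close> onto the
  whole Hardy space (\<open>H_minus_unit_surj\<close>). Second, the factor \<open>1 / (n - c)\<close> in the coefficients
  of \<open>k\<^sub>\<alpha>\<close> cancels \<open>n - cnj c\<close> after conjugation, so that evaluation at the boundary point \<open>\<alpha>\<close>
  becomes an inner product:
  \<open>u(\<alpha>) = (\<Sum>n. u\<^sub>n \<alpha>\<^sup>n) = \<langle>k\<^sub>\<alpha>, (H - cnj c) u\<rangle>\<close> for \<open>u\<close> in \<open>dom_H\<close> (\<open>evaluation_at_boundary\<close>).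

  A function \<open>u\<close> in \<open>dom_H\<close> therefore vanishes on \<open>F\<close> if and only if \<open>(H - cnj c) u\<close> is orthogonal
  to every \<open>k\<^sub>\<alpha>\<close> with \<open>\<alpha> \<in> F\<close>, and by surjectivity the range of \<open>L\<^sub>F - cnj c\<close> is exactly the
  orthogonal complement of these vectors. The kernel of \<open>L\<^sub>F\<^sup>* - c\<close> is the orthogonal complement of
  that range. The defect space is thus the double orthogonal complement of
  \<open>{k\<^sub>\<alpha> | \<alpha> \<in> F}\<close> (\<open>defect_space_eq_double_complement\<close>), which is their closed linear span
  (\<open>double_orthogonal_complement_subset_closure\<close>).

  It remains to compute the Gram matrix. Since \<open>(n - c) (n - cnj c) = 1 + n\<^sup>2\<close>, the inner product
  \<open>\<langle>k\<^sub>\<alpha>, k\<^sub>\<beta>\<rangle>\<close> is term by term the series \<open>Z(\<alpha> - \<beta>)\<close> (\<open>hinner_kernel_vector\<close>). So the linear map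
  that sends the unit mass at \<open>\<alpha>\<close> to \<open>k\<^sub>\<alpha>\<close> preserves inner products, has dense range in the defect
  space, and exhibits it as the completion \<open>\<H>(Z)\<close>.
\<close>

section \<open>Orthogonal complements in Hilbert spaces\<close>

text \<open>
  The nearest point \<open>p\<close> to \<open>x\<close> in the closure of \<open>S\<close> exists by completeness, and \<open>x - p\<close> is
  orthogonal to \<open>S\<close>. The hypothesis then makes \<open>x - p\<close> orthogonal to \<open>x\<close>, hence to itself.
\<close>

lemma double_orthogonal_complement_subset_closure:
  fixes S :: "'a::{real_inner, complete_space} set"
  assumes S: "subspace S"
    and x: "\<And>w. (\<And>s. s \<in> S \<Longrightarrow> inner s w = 0) \<Longrightarrow> inner x w = 0"
  shows "x \<in> closure S"
proof -
  define d where "d = infdist x S"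
  have S0: "S \<noteq> {}" using S subspace_0 by blast
  have d0: "0 \<le> d" by (simp add: d_def infdist_nonneg)
  have d_le: "d\<^sup>2 \<le> (norm (x - s))\<^sup>2" if "s \<in> S" for s
    using infdist_le[OF that, of x] d0 by (intro power_mono) (auto simp: d_def dist_norm)
  have "\<exists>s\<in>S. (norm (x - s))\<^sup>2 < d\<^sup>2 + \<epsilon>" if "\<epsilon> > 0" for \<epsilon>
  proof -
    have "d < sqrt (d\<^sup>2 + \<epsilon>)" using d0 that by (intro real_less_rsqrt) auto
    then obtain s where "s \<in> S" "dist x s < sqrt (d\<^sup>2 + \<epsilon>)"
      using cInf_lessD[of "dist x ` S"] S0 by (auto simp: d_def infdist_notempty)
    moreover from this have "(dist x s)\<^sup>2 < (sqrt (d\<^sup>2 + \<epsilon>))\<^sup>2"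
      by (intro power_strict_mono) auto
    ultimately show ?thesis using that by (auto simp: dist_norm intro!: bexI[of _ s])
  qed
  then have "\<forall>n. \<exists>s\<in>S. (norm (x - s))\<^sup>2 < d\<^sup>2 + inverse (real (Suc n))" by simp
  then obtain s where sS: "\<And>n. s n \<in> S"
    and s: "\<And>n. (norm (x - s n))\<^sup>2 < d\<^sup>2 + inverse (real (Suc n))" by metis
  \<comment> \<open>The parallelogram law turns nearly minimal distances into the Cauchy property.\<close>
  have par: "(norm (s m - s n))\<^sup>2 < 2 * inverse (real (Suc m)) + 2 * inverse (real (Suc n))" for m n
  proof -
    have "(1/2) *\<^sub>R (s m + s n) \<in> S" using S sS by (simp add: subspace_add subspace_scale)
    note d_le[OF this]
    moreover have "(norm (s m - s n))\<^sup>2 + 4 * (norm (x - (1/2) *\<^sub>R (s m + s n)))\<^sup>2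
        = 2 * (norm (x - s m))\<^sup>2 + 2 * (norm (x - s n))\<^sup>2"
      by (simp add: power2_norm_eq_inner inner_diff inner_add inner_commute algebra_simps)
    ultimately show ?thesis using s[of m] s[of n] by linarith
  qed
  have "Cauchy s"
  proof (rule metric_CauchyI)
    fix \<epsilon> :: real assume \<epsilon>: "\<epsilon> > 0"
    then obtain N where N: "inverse (real (Suc N)) < \<epsilon>\<^sup>2 / 4"
      using reals_Archimedean[of "\<epsilon>\<^sup>2 / 4"] by auto
    have "dist (s m) (s n) < \<epsilon>" if "m \<ge> N" "n \<ge> N" for m n
    proof -
      have "inverse (real (Suc m)) \<le> inverse (real (Suc N))"
        "inverse (real (Suc n)) \<le> inverse (real (Suc N))" using that by auto
      with par[of m n] N have "(norm (s m - s n))\<^sup>2 < \<epsilon>\<^sup>2" by linarith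
      then show ?thesis using \<epsilon> by (simp add: dist_norm power_less_imp_less_base)
    qed
    then show "\<exists>N. \<forall>m\<ge>N. \<forall>n\<ge>N. dist (s m) (s n) < \<epsilon>" by blast
  qed
  then obtain p where p: "s \<longlonglongrightarrow> p" using Cauchy_convergent convergent_def by blast
  define w where "w = x - p"
  have "inner t w = 0" if "t \<in> S" for t
  proof (cases "t = 0")
    case False
    \<comment> \<open>The value of \<open>r\<close> that minimizes the distance from \<open>w\<close> to \<open>r *\<^sub>R t\<close>.\<close>
    define r where "r = inner t w / (norm t)\<^sup>2"
    have "(\<lambda>n. (norm (x - s n))\<^sup>2) \<longlonglongrightarrow> (norm w)\<^sup>2"
      unfolding w_def by (intro tendsto_intros p)
    moreover have "(\<lambda>n. d\<^sup>2 + inverse (real (Suc n))) \<longlonglongrightarrow> d\<^sup>2 + 0"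
      by (intro tendsto_intros LIMSEQ_inverse_real_of_nat)
    ultimately have "(norm w)\<^sup>2 \<le> d\<^sup>2 + 0"
      by (rule LIMSEQ_le) (use s less_imp_le in blast)
    moreover have "(\<lambda>n. (norm (x - (s n + r *\<^sub>R t)))\<^sup>2) \<longlonglongrightarrow> (norm (x - (p + r *\<^sub>R t)))\<^sup>2"
      by (intro tendsto_intros p)
    then have "d\<^sup>2 \<le> (norm (x - (p + r *\<^sub>R t)))\<^sup>2"
      by (rule LIMSEQ_le_const)
         (use S sS that d_le in \<open>auto intro!: exI[of _ 0] simp: subspace_add subspace_scale\<close>)
    moreover have "x - (p + r *\<^sub>R t) = w - r *\<^sub>R t" by (simp add: w_def)
    ultimately have "(norm w)\<^sup>2 \<le> (norm (w - r *\<^sub>R t))\<^sup>2" by (metis add_0_right order_trans)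
    also have "\<dots> = (norm w)\<^sup>2 - 2 * r * inner t w + r * r * (norm t)\<^sup>2"
      by (simp add: power2_norm_eq_inner inner_diff inner_commute algebra_simps)
    also have "\<dots> = (norm w)\<^sup>2 - (inner t w)\<^sup>2 / (norm t)\<^sup>2"
      using False by (simp add: r_def field_simps power2_eq_square)
    finally have "(inner t w)\<^sup>2 / (norm t)\<^sup>2 \<le> 0" by simp
    then show ?thesis using False by (simp add: divide_le_0_iff)
  qed simp
  note orth = this
  have "(\<lambda>n. inner (s n) w) \<longlonglongrightarrow> inner p w" by (intro tendsto_intros p)
  then have "inner p w = 0" using orth[OF sS] by (simp add: LIMSEQ_const_iff)
  moreover have "inner x w = 0" using x orth by blast
  ultimately have "inner w w = 0" by (simp add: w_def inner_diff)
  then have "x = p" by (simp add: w_def)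
  then show ?thesis using sS p closure_sequential by blast
qed


section \<open>The Hilbert space of square-summable sequences\<close>

lemma l2_add_summable:
  fixes a b :: "nat \<Rightarrow> complex"
  assumes "summable (\<lambda>k. (cmod (a k))\<^sup>2)" "summable (\<lambda>k. (cmod (b k))\<^sup>2)"
  shows "summable (\<lambda>k. (cmod (a k + b k))\<^sup>2)"
  using l2_diff_summable[OF assms(1), of "\<lambda>k. - b k"] assms(2) by simp

lemma l2_scale_summable:
  fixes a :: "nat \<Rightarrow> complex"
  assumes "summable (\<lambda>k. (cmod (a k))\<^sup>2)"
  shows "summable (\<lambda>k. (cmod (c * a k))\<^sup>2)"
  using summable_mult[OF assms, of "(cmod c)\<^sup>2"] by (simp add: norm_mult power_mult_distrib)

text \<open>
  Carrying the inner product over to a type of its own makes the Cauchy-Schwarz and triangle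
  inequalities and the topology of a real inner product space available. The real inner product
  suffices: the complex one is recovered from it by multiplying one argument by \<open>\<i>\<close>
  (\<open>hinner_eq_0_iff\<close>).
\<close>

typedef l2 = "{a :: nat \<Rightarrow> complex. summable (\<lambda>k. (cmod (a k))\<^sup>2)}"
  morphisms l2_coeff l2_of_coeff
  by (rule exI[of _ "\<lambda>_. 0"]) simp

setup_lifting type_definition_l2

lemma l2_coeff_summable: "summable (\<lambda>k. (cmod (l2_coeff x k))\<^sup>2)"
  using l2_coeff[of x] by simp

instantiation l2 :: real_inner
begin

lift_definition zero_l2 :: l2 is "\<lambda>_. 0" by simp
lift_definition plus_l2 :: "l2 \<Rightarrow> l2 \<Rightarrow> l2" is "\<lambda>a b k. a k + b k" by (rule l2_add_summable)
lift_definition minus_l2 :: "l2 \<Rightarrow> l2 \<Rightarrow> l2" is "\<lambda>a b k. a k - b k" by (rule l2_diff_summable)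
lift_definition uminus_l2 :: "l2 \<Rightarrow> l2" is "\<lambda>a k. - a k" by simp
lift_definition scaleR_l2 :: "real \<Rightarrow> l2 \<Rightarrow> l2" is "\<lambda>r a k. complex_of_real r * a k"
  by (rule l2_scale_summable)
lift_definition inner_l2 :: "l2 \<Rightarrow> l2 \<Rightarrow> real" is "\<lambda>a b. Re (\<Sum>k. cnj (a k) * b k)" .

definition norm_l2 :: "l2 \<Rightarrow> real" where "norm_l2 x = sqrt (inner x x)"
definition dist_l2 :: "l2 \<Rightarrow> l2 \<Rightarrow> real" where "dist_l2 x y = norm (x - y)"
definition sgn_l2 :: "l2 \<Rightarrow> l2" where "sgn_l2 x = inverse (norm x) *\<^sub>R x"
definition uniformity_l2 :: "(l2 \<times> l2) filter" where
  "uniformity_l2 = (INF \<epsilon>\<in>{0<..}. principal {(x, y). dist x y < \<epsilon>})"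
definition open_l2 :: "l2 set \<Rightarrow> bool" where
  "open_l2 U = (\<forall>x\<in>U. eventually (\<lambda>(x', y). x' = x \<longrightarrow> y \<in> U) uniformity)"

instance
proof
  fix x y z :: l2 and r r' :: real
  show "x + y + z = x + (y + z)" "x + y = y + x" "0 + x = x" "- x + x = 0" "x - y = x + - y"
    "r *\<^sub>R (x + y) = r *\<^sub>R x + r *\<^sub>R y" "(r + r') *\<^sub>R x = r *\<^sub>R x + r' *\<^sub>R x"
    "r *\<^sub>R r' *\<^sub>R x = (r * r') *\<^sub>R x" "1 *\<^sub>R x = x"
    by (transfer; simp add: algebra_simps)+
  show "inner x y = inner y x"
  proof transfer
    fix a b :: "nat \<Rightarrow> complex"
    assume ab: "summable (\<lambda>k. (cmod (a k))\<^sup>2)" "summable (\<lambda>k. (cmod (b k))\<^sup>2)"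
    show "Re (\<Sum>k. cnj (a k) * b k) = Re (\<Sum>k. cnj (b k) * a k)"
      using l2_mult_summable[OF ab] l2_mult_summable[OF ab(2,1)]
      by (simp add: Re_suminf mult.commute)
  qed
  show "inner (x + y) z = inner x z + inner y z"
  proof transfer
    fix a b d :: "nat \<Rightarrow> complex"
    assume "summable (\<lambda>k. (cmod (a k))\<^sup>2)" "summable (\<lambda>k. (cmod (b k))\<^sup>2)"
      "summable (\<lambda>k. (cmod (d k))\<^sup>2)"
    then show "Re (\<Sum>k. cnj (a k + b k) * d k) =
        Re (\<Sum>k. cnj (a k) * d k) + Re (\<Sum>k. cnj (b k) * d k)"
      using suminf_add[OF l2_mult_summable l2_mult_summable, of a d b d]
      by (simp add: distrib_right flip: plus_complex.sel)
  qed
  show "inner (r *\<^sub>R x) y = r * inner x y"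
  proof transfer
    fix r and a b :: "nat \<Rightarrow> complex"
    assume "summable (\<lambda>k. (cmod (a k))\<^sup>2)" "summable (\<lambda>k. (cmod (b k))\<^sup>2)"
    then show "Re (\<Sum>k. cnj (complex_of_real r * a k) * b k) = r * Re (\<Sum>k. cnj (a k) * b k)"
      using suminf_mult[OF l2_mult_summable, of a b "complex_of_real r"] by (simp add: mult.assoc)
  qed
  have self: "inner x x = (\<Sum>k. (cmod (l2_coeff x k))\<^sup>2)"
    using Re_suminf[OF l2_mult_summable[OF l2_coeff_summable[of x] l2_coeff_summable[of x]]]
    by (simp add: inner_l2.rep_eq cmod_power2 flip: power2_eq_square)
  show "0 \<le> inner x x" unfolding self by (intro suminf_nonneg l2_coeff_summable) simp
  have "inner x x = 0 \<longleftrightarrow> l2_coeff x = (\<lambda>_. 0)"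
    unfolding self by (subst suminf_eq_zero_iff[OF l2_coeff_summable]) auto
  then show "inner x x = 0 \<longleftrightarrow> x = 0"
    by (simp add: l2_coeff_inject[symmetric] zero_l2.rep_eq)
qed (simp_all add: norm_l2_def dist_l2_def sgn_l2_def uniformity_l2_def open_l2_def)

end

lemma norm_l2_eq: "norm x = sqrt (\<Sum>k. (cmod (l2_coeff x k))\<^sup>2)"
  using Re_suminf[OF l2_mult_summable[OF l2_coeff_summable[of x] l2_coeff_summable[of x]]]
  by (simp add: norm_l2_def inner_l2.rep_eq cmod_power2 flip: power2_eq_square)

lemma l2_partial_sum_le: "(\<Sum>k<n. (cmod (l2_coeff x k))\<^sup>2) \<le> (norm x)\<^sup>2"
  using sum_le_suminf[OF l2_coeff_summable, of "{..<n}" x]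
  by (simp add: norm_l2_eq suminf_nonneg l2_coeff_summable)

lemma l2_coeff_le_norm: "cmod (l2_coeff x k) \<le> norm x"
proof -
  have "(cmod (l2_coeff x k))\<^sup>2 \<le> (\<Sum>j<Suc k. (cmod (l2_coeff x j))\<^sup>2)"
    by (intro member_le_sum) auto
  also have "\<dots> \<le> (norm x)\<^sup>2" by (rule l2_partial_sum_le)
  finally show ?thesis by (simp add: power2_le_iff_abs_le)
qed

text \<open>
  A Cauchy sequence converges coordinatewise. Bounds on partial sums, which involve finitely many
  coordinates, survive the coordinatewise limit; they show that the limit is square-summable and
  that the convergence takes place in norm.
\<close>

instance l2 :: complete_space
proof
  fix X :: "nat \<Rightarrow> l2" assume X: "Cauchy X"
  have "Cauchy (\<lambda>n. l2_coeff (X n) k)" for k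
  proof (rule metric_CauchyI)
    fix \<epsilon> :: real assume "\<epsilon> > 0"
    then obtain N where N: "\<And>m n. m \<ge> N \<Longrightarrow> n \<ge> N \<Longrightarrow> dist (X m) (X n) < \<epsilon>"
      using metric_CauchyD[OF X] by blast
    have "dist (l2_coeff (X m) k) (l2_coeff (X n) k) < \<epsilon>" if "m \<ge> N" "n \<ge> N" for m n
      using l2_coeff_le_norm[of "X m - X n" k] N[OF that] by (simp add: dist_norm minus_l2.rep_eq)
    then show "\<exists>N. \<forall>m\<ge>N. \<forall>n\<ge>N. dist (l2_coeff (X m) k) (l2_coeff (X n) k) < \<epsilon>" by blast
  qed
  then have "\<forall>k. \<exists>L. (\<lambda>n. l2_coeff (X n) k) \<longlonglongrightarrow> L"
    using Cauchy_convergent convergent_def by blast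
  then obtain a where a: "\<And>k. (\<lambda>n. l2_coeff (X n) k) \<longlonglongrightarrow> a k" by metis
  have near: "\<exists>N. \<forall>n\<ge>N. \<forall>j. (\<Sum>k<j. (cmod (l2_coeff (X n) k - a k))\<^sup>2) \<le> \<epsilon>\<^sup>2"
    if "\<epsilon> > 0" for \<epsilon>
  proof -
    obtain N where N: "\<And>m n. m \<ge> N \<Longrightarrow> n \<ge> N \<Longrightarrow> dist (X m) (X n) < \<epsilon>"
      using metric_CauchyD[OF X \<open>\<epsilon> > 0\<close>] by blast
    have "(\<Sum>k<j. (cmod (l2_coeff (X n) k - a k))\<^sup>2) \<le> \<epsilon>\<^sup>2" if n: "n \<ge> N" for n j
    proof (rule LIMSEQ_le_const2)
      show "(\<lambda>m. \<Sum>k<j. (cmod (l2_coeff (X n) k - l2_coeff (X m) k))\<^sup>2)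
          \<longlonglongrightarrow> (\<Sum>k<j. (cmod (l2_coeff (X n) k - a k))\<^sup>2)"
        by (intro tendsto_intros a)
      have "(\<Sum>k<j. (cmod (l2_coeff (X n) k - l2_coeff (X m) k))\<^sup>2) \<le> \<epsilon>\<^sup>2" if "m \<ge> N" for m
      proof -
        have "(norm (X n - X m))\<^sup>2 \<le> \<epsilon>\<^sup>2"
          using N[OF n that] by (intro power_mono) (auto simp: dist_norm)
        then show ?thesis
          using l2_partial_sum_le[where n = j and x = "X n - X m"] by (simp add: minus_l2.rep_eq)
      qed
      then show "\<exists>N. \<forall>m\<ge>N. (\<Sum>k<j. (cmod (l2_coeff (X n) k - l2_coeff (X m) k))\<^sup>2) \<le> \<epsilon>\<^sup>2"
        by blast
    qed
    then show ?thesis by blast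
  qed
  obtain N where "\<And>j. (\<Sum>k<j. (cmod (l2_coeff (X N) k - a k))\<^sup>2) \<le> 1\<^sup>2"
    using near[of 1] by auto
  then have "summable (\<lambda>k. (cmod (l2_coeff (X N) k - a k))\<^sup>2)"
    by (intro summableI_nonneg_bounded) auto
  from l2_diff_summable[OF l2_coeff_summable[of "X N"] this]
  have "summable (\<lambda>k. (cmod (a k))\<^sup>2)" by simp
  then have co: "l2_coeff (l2_of_coeff a) = a" by (simp add: l2_of_coeff_inverse)
  have "X \<longlonglongrightarrow> l2_of_coeff a"
  proof (rule metric_LIMSEQ_I)
    fix \<epsilon> :: real assume \<epsilon>: "\<epsilon> > 0"
    then obtain N where N: "\<And>n j. n \<ge> N \<Longrightarrow> (\<Sum>k<j. (cmod (l2_coeff (X n) k - a k))\<^sup>2) \<le> (\<epsilon>/2)\<^sup>2"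
      using near[of "\<epsilon>/2"] by auto
    have "dist (X n) (l2_of_coeff a) < \<epsilon>" if "n \<ge> N" for n
    proof -
      have "(\<Sum>k. (cmod (l2_coeff (X n - l2_of_coeff a) k))\<^sup>2) \<le> (\<epsilon>/2)\<^sup>2"
        using N[OF that] by (intro suminf_le_const l2_coeff_summable) (simp add: minus_l2.rep_eq co)
      then have "norm (X n - l2_of_coeff a) \<le> \<epsilon>/2"
        unfolding norm_l2_eq using \<epsilon> by (intro real_le_lsqrt) auto
      then show ?thesis using \<epsilon> by (simp add: dist_norm)
    qed
    then show "\<exists>N. \<forall>n\<ge>N. dist (X n) (l2_of_coeff a) < \<epsilon>" by blast
  qed
  then show "convergent X" by (auto simp: convergent_def)
qed


section \<open>Taylor coefficients of Hardy functions\<close>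

text \<open>
  Coefficients are identified through formal power series, because the calculus of
  \<open>has_fps_expansion\<close> covers the operations needed below, including \<open>z d/dz\<close>.
\<close>

lemma tcoeff_eqI: "f has_fps_expansion P \<Longrightarrow> tcoeff f k = fps_nth P k"
  by (metis tcoeff_def analytic_at_imp_has_fps_expansion_0 fps_expansion_unique_complex
      has_fps_expansion_imp_analytic_0)

lemma hardy2_has_fps_expansion: "f \<in> hardy2 \<Longrightarrow> f has_fps_expansion fps_expansion f 0"
  by (rule has_fps_expansion_fps_expansion[of "ball 0 1"]) (auto simp: hardy2_def)

lemma hardy2_summable: "f \<in> hardy2 \<Longrightarrow> summable (\<lambda>k. (cmod (tcoeff f k))\<^sup>2)"
  by (simp add: hardy2_def)

lemma hardy2_power_series:
  assumes "f \<in> hardy2" "z \<in> ball 0 1"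
  shows "(\<lambda>n. tcoeff f n * z ^ n) sums f z"
  using assms holomorphic_power_series[of f 0 1 z]
  by (auto simp: hardy2_def tcoeff_def fps_expansion_def)

lemma
  assumes "f \<in> hardy2" "g \<in> hardy2"
  shows tcoeff_add_hardy2: "tcoeff (\<lambda>z. f z + g z) k = tcoeff f k + tcoeff g k"
    and tcoeff_diff_hardy2: "tcoeff (\<lambda>z. f z - g z) k = tcoeff f k - tcoeff g k"
proof -
  note fg = assms[THEN hardy2_has_fps_expansion]
  show "tcoeff (\<lambda>z. f z + g z) k = tcoeff f k + tcoeff g k"
    using tcoeff_eqI[OF has_fps_expansion_add[OF fg]] by (simp add: tcoeff_def)
  show "tcoeff (\<lambda>z. f z - g z) k = tcoeff f k - tcoeff g k"
    using assms by (intro tcoeff_diff) (auto simp: hardy2_def)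
qed

lemma
  assumes "f \<in> hardy2"
  shows tcoeff_cmult_hardy2: "tcoeff (\<lambda>z. c * f z) k = c * tcoeff f k"
    and tcoeff_opH: "tcoeff (opH f) k = of_nat k * tcoeff f k"
proof -
  note f = hardy2_has_fps_expansion[OF assms]
  show "tcoeff (\<lambda>z. c * f z) k = c * tcoeff f k"
    using tcoeff_eqI[OF has_fps_expansion_cmult_left[OF f]] by (simp add: tcoeff_def)
  have "(\<lambda>z. z * deriv f z) has_fps_expansion fps_X * fps_deriv (fps_expansion f 0)"
    by (intro fps_expansion_intros f)
  moreover have ev: "eventually (\<lambda>z. z * deriv f z = opH f z) (nhds 0)"
    using eventually_nhds_in_open[of "ball 0 1" "0::complex"]
    by (auto simp: opH_def elim: eventually_mono)
  ultimately have "opH f has_fps_expansion fps_X * fps_deriv (fps_expansion f 0)"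
    using has_fps_expansion_cong[OF ev refl] by blast
  from tcoeff_eqI[OF this] show "tcoeff (opH f) k = of_nat k * tcoeff f k"
    by (cases k) (auto simp: tcoeff_def)
qed

lemma zero_hardy2: "(\<lambda>z. 0) \<in> hardy2" and tcoeff_zero: "tcoeff (\<lambda>z. 0) k = 0"
proof -
  show "tcoeff (\<lambda>z. 0) k = 0" for k using tcoeff_eqI[of "\<lambda>z. 0" 0] by simp
  then show "(\<lambda>z. 0) \<in> hardy2" by (simp add: hardy2_def)
qed

lemma add_hardy2: "f \<in> hardy2 \<Longrightarrow> g \<in> hardy2 \<Longrightarrow> (\<lambda>z. f z + g z) \<in> hardy2"
  using l2_add_summable[OF hardy2_summable hardy2_summable, of f g]
  by (subst hardy2_def) (auto simp: tcoeff_add_hardy2 hardy2_def[THEN eqset_imp_iff]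
      intro!: holomorphic_intros)

lemma diff_hardy2: "f \<in> hardy2 \<Longrightarrow> g \<in> hardy2 \<Longrightarrow> (\<lambda>z. f z - g z) \<in> hardy2"
  using l2_diff_summable[OF hardy2_summable hardy2_summable, of f g]
  by (subst hardy2_def) (auto simp: tcoeff_diff_hardy2 hardy2_def[THEN eqset_imp_iff]
      intro!: holomorphic_intros)

lemma cmult_hardy2: "f \<in> hardy2 \<Longrightarrow> (\<lambda>z. c * f z) \<in> hardy2"
  using l2_scale_summable[OF hardy2_summable, of f c]
  by (subst hardy2_def) (auto simp: tcoeff_cmult_hardy2 hardy2_def[THEN eqset_imp_iff]
      intro!: holomorphic_intros)

definition hardy_of_coeff :: "(nat \<Rightarrow> complex) \<Rightarrow> complex \<Rightarrow> complex" where
  "hardy_of_coeff a = (\<lambda>z. if z \<in> ball 0 1 then \<Sum>n. a n * z ^ n else 0)"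

text \<open>
  Together with the coefficient map this identifies the Hardy space with the square-summable
  sequences: the coefficients are bounded, so the series converges on the disk by comparison with
  a geometric one.
\<close>

lemma
  assumes "summable (\<lambda>k. (cmod (a k))\<^sup>2)"
  shows hardy_of_coeff_hardy2: "hardy_of_coeff a \<in> hardy2"
    and tcoeff_hardy_of_coeff: "tcoeff (hardy_of_coeff a) = a"
proof -
  have "Bseq a"
    using summable_LIMSEQ_zero[OF assms] tendsto_power[of _ 0 _ 1]
    by (intro convergent_imp_Bseq convergentI[of _ 0])
       (auto simp: tendsto_norm_zero_iff dest: tendsto_real_sqrt)
  then obtain B where B: "\<And>n. cmod (a n) \<le> B" by (auto simp: Bseq_def)
  have "fps_conv_radius (Abs_fps a) \<ge> 1"
    unfolding fps_conv_radius_def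
  proof (rule conv_radius_geI_ex')
    fix r :: real assume r: "0 < r" "ereal r < 1"
    show "summable (\<lambda>n. fps_nth (Abs_fps a) n * of_real r ^ n)"
    proof (rule summable_comparison_test')
      show "summable (\<lambda>n. B * r ^ n)" using r by (intro summable_mult summable_geometric) auto
      show "norm (fps_nth (Abs_fps a) n * of_real r ^ n) \<le> B * r ^ n" if "n \<ge> 0" for n
        using B[of n] r by (auto simp: norm_mult norm_power intro!: mult_right_mono)
    qed
  qed
  then have R: "ball 0 1 \<subseteq> eball (0::complex) (fps_conv_radius (Abs_fps a))"
    by (auto simp: eball_def intro: less_le_trans[of _ "1::ereal"])
  have eq: "hardy_of_coeff a z = eval_fps (Abs_fps a) z" if "z \<in> ball 0 1" for z
    using that by (simp add: hardy_of_coeff_def eval_fps_def)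
  have "eventually (\<lambda>z. eval_fps (Abs_fps a) z = hardy_of_coeff a z) (nhds 0)"
    using eventually_nhds_in_open[of "ball 0 1" "0::complex"]
    by (auto simp: eq elim: eventually_mono)
  moreover have "fps_conv_radius (Abs_fps a) > 0"
    using \<open>fps_conv_radius (Abs_fps a) \<ge> 1\<close> by (rule less_le_trans[rotated]) simp
  ultimately have "hardy_of_coeff a has_fps_expansion Abs_fps a"
    by (simp add: has_fps_expansion_def)
  from tcoeff_eqI[OF this] show tc: "tcoeff (hardy_of_coeff a) = a" by auto
  have "hardy_of_coeff a holomorphic_on ball 0 1"
    using holomorphic_on_eval_fps[OF R] by (rule holomorphic_transform) (simp add: eq)
  then show "hardy_of_coeff a \<in> hardy2"
    using assms by (auto simp: hardy2_def tc) (simp add: hardy_of_coeff_def)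
qed


section \<open>The inner product of the Hardy space\<close>

definition to_l2 :: "(complex \<Rightarrow> complex) \<Rightarrow> l2" where
  "to_l2 f = l2_of_coeff (tcoeff f)"

lemma l2_coeff_to_l2: "f \<in> hardy2 \<Longrightarrow> l2_coeff (to_l2 f) = tcoeff f"
  by (simp add: to_l2_def l2_of_coeff_inverse hardy2_summable)

lemma to_l2_surj: obtains f where "f \<in> hardy2" "to_l2 f = x"
proof
  show "hardy_of_coeff (l2_coeff x) \<in> hardy2"
    by (intro hardy_of_coeff_hardy2 l2_coeff_summable)
  show "to_l2 (hardy_of_coeff (l2_coeff x)) = x"
    by (simp add: to_l2_def tcoeff_hardy_of_coeff l2_coeff_summable l2_coeff_inverse)
qed

lemma to_l2_add: "f \<in> hardy2 \<Longrightarrow> g \<in> hardy2 \<Longrightarrow> to_l2 (\<lambda>z. f z + g z) = to_l2 f + to_l2 g"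
  by (auto simp: l2_coeff_inject[symmetric] l2_coeff_to_l2 add_hardy2 plus_l2.rep_eq
      tcoeff_add_hardy2)

lemma to_l2_diff: "f \<in> hardy2 \<Longrightarrow> g \<in> hardy2 \<Longrightarrow> to_l2 (\<lambda>z. f z - g z) = to_l2 f - to_l2 g"
  by (auto simp: l2_coeff_inject[symmetric] l2_coeff_to_l2 diff_hardy2 minus_l2.rep_eq
      tcoeff_diff_hardy2)

lemma to_l2_scaleR: "f \<in> hardy2 \<Longrightarrow> to_l2 (\<lambda>z. complex_of_real r * f z) = r *\<^sub>R to_l2 f"
  by (auto simp: l2_coeff_inject[symmetric] l2_coeff_to_l2 cmult_hardy2 scaleR_l2.rep_eq
      tcoeff_cmult_hardy2)

lemma inner_to_l2: "f \<in> hardy2 \<Longrightarrow> g \<in> hardy2 \<Longrightarrow> inner (to_l2 f) (to_l2 g) = Re (hinner f g)"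
  by (simp add: inner_l2.rep_eq l2_coeff_to_l2 hinner_def)

lemma hnorm_diff_eq_dist:
  "f \<in> hardy2 \<Longrightarrow> g \<in> hardy2 \<Longrightarrow> hnorm (\<lambda>z. f z - g z) = dist (to_l2 f) (to_l2 g)"
  by (simp add: dist_norm to_l2_diff[symmetric] norm_l2_eq hnorm_def l2_coeff_to_l2 diff_hardy2)

lemma hinner_sums:
  "f \<in> hardy2 \<Longrightarrow> g \<in> hardy2 \<Longrightarrow> (\<lambda>k. cnj (tcoeff f k) * tcoeff g k) sums hinner f g"
  unfolding hinner_def by (intro summable_sums l2_mult_summable hardy2_summable)

lemma hinner_commute:
  assumes "f \<in> hardy2" "g \<in> hardy2"
  shows "hinner g f = cnj (hinner f g)"
proof (rule sums_unique2)
  show "(\<lambda>k. cnj (tcoeff g k) * tcoeff f k) sums hinner g f" by (intro hinner_sums assms)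
  show "(\<lambda>k. cnj (tcoeff g k) * tcoeff f k) sums cnj (hinner f g)"
    using sums_cnj[THEN iffD2, OF hinner_sums[OF assms]] by (simp add: mult.commute[of "tcoeff f _"])
qed

lemma
  assumes "f \<in> hardy2" "g \<in> hardy2" "h \<in> hardy2"
  shows hinner_add_right: "hinner f (\<lambda>z. g z + h z) = hinner f g + hinner f h"
    and hinner_diff_left: "hinner (\<lambda>z. g z - h z) f = hinner g f - hinner h f"
proof -
  note S = hinner_sums[OF assms(1,2)] hinner_sums[OF assms(1,3)]
    hinner_sums[OF assms(2,1)] hinner_sums[OF assms(3,1)]
  show "hinner f (\<lambda>z. g z + h z) = hinner f g + hinner f h"
    using sums_add[OF S(1,2)] assms
    by (subst hinner_def) (simp add: tcoeff_add_hardy2 sums_iff algebra_simps)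
  show "hinner (\<lambda>z. g z - h z) f = hinner g f - hinner h f"
    using sums_diff[OF S(3,4)] assms
    by (subst hinner_def) (simp add: tcoeff_diff_hardy2 sums_iff algebra_simps)
qed

lemma
  assumes "f \<in> hardy2" "g \<in> hardy2"
  shows hinner_cmult_right: "hinner f (\<lambda>z. c * g z) = c * hinner f g"
    and hinner_cmult_left: "hinner (\<lambda>z. c * f z) g = cnj c * hinner f g"
proof -
  note S = hinner_sums[OF assms]
  show "hinner f (\<lambda>z. c * g z) = c * hinner f g"
    using sums_mult[OF S, of c] assms
    by (subst hinner_def) (simp add: tcoeff_cmult_hardy2 sums_iff algebra_simps)
  show "hinner (\<lambda>z. c * f z) g = cnj c * hinner f g"
    using sums_mult[OF S, of "cnj c"] assms
    by (subst hinner_def) (simp add: tcoeff_cmult_hardy2 sums_iff algebra_simps)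
qed

lemma hinner_zero_right: "hinner f (\<lambda>z. 0) = 0"
  by (simp add: hinner_def tcoeff_zero)

lemma
  assumes "finite A" "g \<in> hardy2" "\<And>a. f a \<in> hardy2"
  shows sum_hardy2: "(\<lambda>z. \<Sum>a\<in>A. c a * f a z) \<in> hardy2"
    and hinner_sum_right: "hinner g (\<lambda>z. \<Sum>a\<in>A. c a * f a z) = (\<Sum>a\<in>A. c a * hinner g (f a))"
proof -
  have "(\<lambda>z. \<Sum>a\<in>A. c a * f a z) \<in> hardy2 \<and>
      hinner g (\<lambda>z. \<Sum>a\<in>A. c a * f a z) = (\<Sum>a\<in>A. c a * hinner g (f a))"
    using assms(1)
  proof induction
    case empty
    show ?case by (simp add: zero_hardy2 hinner_zero_right)
  next
    case (insert b A)
    then show ?case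
      using assms(2,3) by (simp add: add_hardy2 cmult_hardy2 hinner_add_right hinner_cmult_right)
  qed
  then show "(\<lambda>z. \<Sum>a\<in>A. c a * f a z) \<in> hardy2"
    "hinner g (\<lambda>z. \<Sum>a\<in>A. c a * f a z) = (\<Sum>a\<in>A. c a * hinner g (f a))" by auto
qed

text \<open>
  The imaginary part of \<open>\<langle>f, g\<rangle>\<close> is the real part of \<open>\<langle>\<i> f, g\<rangle>\<close>, so that complex orthogonality can
  be tested in the real inner product space \<open>l2\<close>.
\<close>

lemma hinner_eq_0_iff:
  assumes "f \<in> hardy2" "g \<in> hardy2"
  shows "hinner f g = 0 \<longleftrightarrow>
    inner (to_l2 f) (to_l2 g) = 0 \<and> inner (to_l2 (\<lambda>z. \<i> * f z)) (to_l2 g) = 0"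
  using assms by (simp add: inner_to_l2 cmult_hardy2 hinner_cmult_left complex_eq_iff)


section \<open>Boundary values\<close>

text \<open>
  Write \<open>\<bar>u\<^sub>n\<bar>\<close> as the product of \<open>n \<bar>u\<^sub>n\<bar>\<close> and \<open>1/n\<close>, both square-summable.
\<close>

lemma dom_H_summable:
  assumes "u \<in> dom_H"
  shows "summable (\<lambda>n. cmod (tcoeff u n))"
proof (rule summable_comparison_test')
  have u: "u \<in> hardy2" "opH u \<in> hardy2" using assms by (auto simp: dom_H_def)
  show "summable (\<lambda>n. (cmod (tcoeff (opH u) n))\<^sup>2 + inverse ((real n)\<^sup>2))"
    using inverse_power_summable[of 2, where ?'a = real]
    by (intro summable_add hardy2_summable u) auto
  fix n :: nat assume n: "n \<ge> 1"
  define x y where "x = real n * cmod (tcoeff u n)" and "y = inverse (real n)"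
  have "x * y \<le> x\<^sup>2 + y\<^sup>2"
  proof -
    have "0 \<le> x * y" by (simp add: x_def y_def)
    with sum_squares_bound[of x y] show ?thesis by linarith
  qed
  moreover have "x * y = cmod (tcoeff u n)" using n by (simp add: x_def y_def)
  ultimately have "cmod (tcoeff u n) \<le> x\<^sup>2 + y\<^sup>2" by simp
  then show "norm (cmod (tcoeff u n)) \<le> (cmod (tcoeff (opH u) n))\<^sup>2 + inverse ((real n)\<^sup>2)"
    by (simp add: tcoeff_opH[OF u(1)] norm_mult x_def y_def power_inverse)
qed

text \<open>
  By absolute summability of the coefficients the power series converges uniformly on the closed
  disk, so it is the continuous extension of \<open>u\<close>.
\<close>

lemma dom_H_boundary_value:
  assumes u: "u \<in> dom_H" and \<zeta>: "\<zeta> \<in> sphere 0 1"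
  shows "(u \<longlongrightarrow> (\<Sum>n. tcoeff u n * \<zeta> ^ n)) (at \<zeta> within ball 0 1)"
proof -
  define g where "g = (\<lambda>z. \<Sum>n. tcoeff u n * z ^ n)"
  have "uniform_limit (cball 0 1) (\<lambda>n z. \<Sum>k<n. tcoeff u k * z ^ k) g sequentially"
    unfolding g_def
  proof (rule Weierstrass_m_test)
    show "summable (\<lambda>n. cmod (tcoeff u n))" using u by (rule dom_H_summable)
    show "norm (tcoeff u n * z ^ n) \<le> cmod (tcoeff u n)" if "z \<in> cball 0 1" for n z
      using that by (simp add: norm_mult norm_power power_le_one mult_left_le)
  qed
  then have "continuous_on (cball 0 1) g"
    by (rule uniform_limit_theorem[rotated]) (auto intro!: always_eventually continuous_intros)
  then have "(g \<longlongrightarrow> g \<zeta>) (at \<zeta> within cball 0 1)" using \<zeta> by (auto simp: continuous_on_def)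
  then have "(g \<longlongrightarrow> g \<zeta>) (at \<zeta> within ball 0 1)"
    by (rule tendsto_within_subset) (rule ball_subset_cball)
  moreover have "u z = g z" if "z \<in> ball 0 1" for z
    using hardy2_power_series[OF _ that, of u] u by (simp add: dom_H_def g_def sums_iff)
  ultimately show ?thesis
    using Lim_cong_within[of \<zeta> \<zeta> "g \<zeta>" "g \<zeta>" "ball 0 1" "ball 0 1" u g] by (simp add: g_def)
qed

lemma cnj_e: "cnj (e x) = e (- x)"
  by (simp add: e_def exp_cnj)

lemma norm_e: "cmod (e x) = 1"
  by (simp add: e_def norm_exp_eq_Re)

lemma e_mult_e: "e x * e y = e (x + y)"
  by (simp add: e_def exp_add[symmetric] algebra_simps)

lemma unit_circle_power_eq_e:
  assumes "\<alpha> \<in> sphere 0 1"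
  shows "\<alpha> ^ n = e (real n * angle \<alpha>)"
proof -
  have "\<alpha> = of_real (cmod \<alpha>) * exp (\<i> * of_real (Arg2pi \<alpha>))"
    using Arg2pi[of \<alpha>] unfolding is_Arg_def by blast
  then have "\<alpha> = exp (\<i> * of_real (Arg2pi \<alpha>))" using assms by simp
  then have "\<alpha> ^ n = exp (of_nat n * (\<i> * of_real (Arg2pi \<alpha>)))" by (metis exp_of_nat_mult)
  then show ?thesis by (simp add: e_def angle_def algebra_simps)
qed


section \<open>The kernel vectors and the resolvent\<close>

lemma nat_minus_unit_mult_cnj:
  assumes "c \<in> {\<i>, -\<i>}"
  shows "(of_nat n - c) * (of_nat n - cnj c) = 1 + (of_nat n)\<^sup>2"
  using assms by (auto simp: algebra_simps power2_eq_square)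

lemma norm_nat_minus_unit:
  assumes "c \<in> {\<i>, -\<i>}"
  shows "(cmod (of_nat n - c))\<^sup>2 = 1 + (real n)\<^sup>2"
  using assms by (auto simp: cmod_power2)

lemma nat_minus_unit_nonzero: "c \<in> {\<i>, -\<i>} \<Longrightarrow> of_nat n - c \<noteq> 0"
  using norm_nat_minus_unit[of c n] by (auto simp: add_nonneg_eq_0_iff)

lemma
  assumes c: "c \<in> {\<i>, -\<i>}"
  shows kernel_vector_hardy2: "kernel_vector c \<alpha> \<in> hardy2"
    and tcoeff_kernel_vector:
      "tcoeff (kernel_vector c \<alpha>) n = e (- (real n * angle \<alpha>)) / (of_nat n - c)"
proof -
  define a where "a n = e (- (real n * angle \<alpha>)) / (of_nat n - c)" for n
  have k: "kernel_vector c \<alpha> = hardy_of_coeff a"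
    by (simp add: kernel_vector_def hardy_of_coeff_def a_def cong: if_cong)
  have "summable (\<lambda>n. (cmod (a n))\<^sup>2)"
  proof (rule summable_comparison_test')
    show "summable (\<lambda>n. inverse ((real n)\<^sup>2))" by (rule inverse_power_summable) simp
    show "norm ((cmod (a n))\<^sup>2) \<le> inverse ((real n)\<^sup>2)" if "n \<ge> 1" for n
      using that
      by (auto simp: a_def norm_divide power_divide norm_e norm_nat_minus_unit[OF c]
          inverse_eq_divide intro!: frac_le)
  qed
  then show "kernel_vector c \<alpha> \<in> hardy2"
    "tcoeff (kernel_vector c \<alpha>) n = e (- (real n * angle \<alpha>)) / (of_nat n - c)"
    unfolding k by (simp_all add: hardy_of_coeff_hardy2 tcoeff_hardy_of_coeff a_def)
qed

lemma hinner_kernel_vector: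
  assumes c: "c \<in> {\<i>, -\<i>}"
  shows "hinner (kernel_vector c \<alpha>) (kernel_vector c \<beta>) = Z_kernel \<alpha> \<beta>"
proof -
  have "cnj (tcoeff (kernel_vector c \<alpha>) n) * tcoeff (kernel_vector c \<beta>) n =
      e (real n * (angle \<alpha> - angle \<beta>)) / (1 + (of_nat n)\<^sup>2)" for n
  proof -
    have "cnj (tcoeff (kernel_vector c \<alpha>) n) * tcoeff (kernel_vector c \<beta>) n =
      (e (real n * angle \<alpha>) * e (- (real n * angle \<beta>))) / ((of_nat n - c) * (of_nat n - cnj c))"
      by (simp add: tcoeff_kernel_vector[OF c] cnj_e mult.commute)
    then show ?thesis
      unfolding nat_minus_unit_mult_cnj[OF c] e_mult_e by (simp add: algebra_simps)
  qed
  then show ?thesis by (simp add: hinner_def Z_kernel_def Z_def)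
qed

text \<open>
  The coefficient \<open>n - cnj c\<close> of \<open>H - cnj c\<close> cancels the conjugated denominator of the kernel vector.
\<close>

lemma hinner_kernel_vector_dom_H:
  assumes c: "c \<in> {\<i>, -\<i>}" and \<alpha>: "\<alpha> \<in> sphere 0 1" and u: "u \<in> dom_H"
  shows "hinner (kernel_vector c \<alpha>) (\<lambda>z. opH u z - cnj c * u z) = (\<Sum>n. tcoeff u n * \<alpha> ^ n)"
proof -
  have h: "u \<in> hardy2" "opH u \<in> hardy2" using u by (auto simp: dom_H_def)
  have "cnj (tcoeff (kernel_vector c \<alpha>) n) * tcoeff (\<lambda>z. opH u z - cnj c * u z) n =
      tcoeff u n * \<alpha> ^ n" for n
  proof -
    have "of_nat n - cnj c \<noteq> 0" using c by (intro nat_minus_unit_nonzero) auto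
    then show ?thesis
      using h by (simp add: tcoeff_kernel_vector[OF c] cnj_e unit_circle_power_eq_e[OF \<alpha>]
          tcoeff_diff_hardy2 cmult_hardy2 tcoeff_cmult_hardy2 tcoeff_opH
          field_simps)
  qed
  then show ?thesis by (simp add: hinner_def)
qed

lemma evaluation_at_boundary:
  assumes "c \<in> {\<i>, -\<i>}" "\<alpha> \<in> sphere 0 1" "u \<in> dom_H"
  shows "(u \<longlongrightarrow> hinner (kernel_vector c \<alpha>) (\<lambda>z. opH u z - cnj c * u z)) (at \<alpha> within ball 0 1)"
  using dom_H_boundary_value[OF assms(3,2)] hinner_kernel_vector_dom_H[OF assms] by simp

text \<open>
  The preimage is obtained by dividing the \<open>n\<close>-th coefficient by \<open>n - cnj c\<close>. It lies in the domain
  of \<open>H\<close> because \<open>1 / \<bar>n - cnj c\<bar>\<close> and \<open>n / \<bar>n - cnj c\<bar>\<close> are at most 1.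
\<close>

lemma H_minus_unit_surj:
  assumes c: "c \<in> {\<i>, -\<i>}" and w: "w \<in> hardy2"
  obtains u where "u \<in> dom_H" "(\<lambda>z. opH u z - cnj c * u z) = w"
proof
  define a where "a n = tcoeff w n / (of_nat n - cnj c)" for n
  have c': "cnj c \<in> {\<i>, -\<i>}" using c by auto
  have le: "(cmod (of_nat n * a n))\<^sup>2 \<le> (cmod (tcoeff w n))\<^sup>2"
      "(cmod (a n))\<^sup>2 \<le> (cmod (tcoeff w n))\<^sup>2" for n
  proof -
    define t where "t = (cmod (tcoeff w n))\<^sup>2"
    have t: "t \<ge> 0" by (simp add: t_def)
    have eq: "(cmod (a n))\<^sup>2 = t / (1 + (real n)\<^sup>2)"
      by (simp add: a_def t_def norm_divide power_divide norm_nat_minus_unit[OF c'])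
    show "(cmod (a n))\<^sup>2 \<le> (cmod (tcoeff w n))\<^sup>2"
      using frac_le[OF t order_refl, of 1 "1 + (real n)\<^sup>2"] eq by (simp add: t_def)
    have "(cmod (of_nat n * a n))\<^sup>2 = t * ((real n)\<^sup>2 / (1 + (real n)\<^sup>2))"
      by (simp add: norm_mult power_mult_distrib eq)
    also have "\<dots> \<le> t * 1" using t
      by (intro mult_left_mono divide_le_eq_1_pos[THEN iffD2]) (auto intro: add_pos_nonneg)
    finally show "(cmod (of_nat n * a n))\<^sup>2 \<le> (cmod (tcoeff w n))\<^sup>2" by (simp add: t_def)
  qed
  have S: "summable (\<lambda>n. (cmod (of_nat n * a n))\<^sup>2)" "summable (\<lambda>n. (cmod (a n))\<^sup>2)"
    by (rule summable_comparison_test'[OF hardy2_summable[OF w]], use le in simp)+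
  define u where "u = hardy_of_coeff a"
  have u: "u \<in> hardy2" and tu: "tcoeff u = a"
    unfolding u_def using S(2) by (rule hardy_of_coeff_hardy2 tcoeff_hardy_of_coeff)+
  have "(\<lambda>z. z * deriv u z) holomorphic_on ball 0 1"
    using u by (intro holomorphic_intros) (auto simp: hardy2_def)
  then have "opH u holomorphic_on ball 0 1"
    by (rule holomorphic_transform) (simp add: opH_def)
  then have Hu: "opH u \<in> hardy2"
    using S(1) by (auto simp: hardy2_def tcoeff_opH[OF u] tu) (simp add: opH_def)
  then show "u \<in> dom_H" using u by (simp add: dom_H_def)
  show "(\<lambda>z. opH u z - cnj c * u z) = w"
  proof (rule hardy2_eqI)
    show "(\<lambda>z. opH u z - cnj c * u z) \<in> hardy2" by (intro diff_hardy2 cmult_hardy2 u Hu)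
    fix n
    have "tcoeff (\<lambda>z. opH u z - cnj c * u z) n = (of_nat n - cnj c) * a n"
      by (simp add: tcoeff_diff_hardy2 Hu u cmult_hardy2 tcoeff_cmult_hardy2 tcoeff_opH tu
          left_diff_distrib)
    also have "\<dots> = tcoeff w n" using nat_minus_unit_nonzero[OF c', of n] by (simp add: a_def)
    finally show "tcoeff (\<lambda>z. opH u z - cnj c * u z) n = tcoeff w n" .
  qed (rule w)
qed


section \<open>The defect spaces\<close>

text \<open>
  The condition on \<open>w\<close> on the right says that \<open>w\<close> belongs to the range of \<open>L\<^sub>F - cnj c\<close>: write
  \<open>w = (H - cnj c) u\<close> by surjectivity; then \<open>\<langle>k\<^sub>\<alpha>, w\<rangle> = u(\<alpha>)\<close>, so it requires \<open>u = 0\<close> on \<open>F\<close>. And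
  \<open>L\<^sub>F\<^sup>* f = c f\<close> means that \<open>f\<close> is orthogonal to that range.
\<close>

lemma defect_space_eq_double_complement:
  assumes c: "c \<in> {\<i>, -\<i>}" and F: "F \<subseteq> sphere 0 1"
  shows "defect_space c F = {f \<in> hardy2. \<forall>w\<in>hardy2.
           (\<forall>\<alpha>\<in>F. hinner (kernel_vector c \<alpha>) w = 0) \<longrightarrow> hinner w f = 0}"
proof -
  have dom_L: "u \<in> dom_L F \<longleftrightarrow>
      (\<forall>\<alpha>\<in>F. hinner (kernel_vector c \<alpha>) (\<lambda>z. opH u z - cnj c * u z) = 0)"
    if "u \<in> dom_H" for u
  proof -
    have "(u \<longlongrightarrow> 0) (at \<alpha> within ball 0 1) \<longleftrightarrow>
        hinner (kernel_vector c \<alpha>) (\<lambda>z. opH u z - cnj c * u z) = 0" if "\<alpha> \<in> F" for \<alpha>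
    proof -
      have \<alpha>: "\<alpha> \<in> sphere 0 1" using that F by auto
      have "at \<alpha> within ball 0 1 \<noteq> bot"
        using \<alpha> islimpt_ball[of \<alpha> 0 1] by (simp add: trivial_limit_within)
      then show ?thesis
        using evaluation_at_boundary[OF c \<alpha> \<open>u \<in> dom_H\<close>] by (auto dest: tendsto_unique)
    qed
    then show ?thesis using that by (auto simp: dom_L_def)
  qed
  have adj: "f \<in> defect_space c F \<longleftrightarrow> (f, \<lambda>z. c * f z) \<in> adjoint (opL F)" for f
    by (auto simp: defect_space_def)
  have mem: "f \<in> defect_space c F \<longleftrightarrow>
      f \<in> hardy2 \<and> (\<forall>u\<in>dom_L F. hinner (\<lambda>z. opH u z - cnj c * u z) f = 0)" for f
  proof (cases "f \<in> hardy2")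
    case f: True
    have "hinner (\<lambda>z. opH u z - cnj c * u z) f = 0 \<longleftrightarrow> hinner (opH u) f = hinner u (\<lambda>z. c * f z)"
      if "u \<in> dom_L F" for u
    proof -
      have u: "u \<in> hardy2" "opH u \<in> hardy2" using that by (auto simp: dom_L_def dom_H_def)
      have "hinner (\<lambda>z. opH u z - cnj c * u z) f = hinner (opH u) f - c * hinner u f"
        using f u by (simp add: hinner_diff_left cmult_hardy2 hinner_cmult_left)
      then show ?thesis using f u by (simp add: hinner_cmult_right)
    qed
    then show ?thesis
      using f by (fastforce simp: adj adjoint_def opL_def cmult_hardy2)
  qed (simp add: adj adjoint_def)
  show ?thesis
  proof (intro set_eqI iffI)
    fix f assume f: "f \<in> defect_space c F"
    have "hinner w f = 0"
      if w: "w \<in> hardy2" "\<forall>\<alpha>\<in>F. hinner (kernel_vector c \<alpha>) w = 0" for w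
    proof -
      obtain u where u: "u \<in> dom_H" "(\<lambda>z. opH u z - cnj c * u z) = w"
        using H_minus_unit_surj[OF c w(1)] by blast
      then have "u \<in> dom_L F" using dom_L w(2) by simp
      then show ?thesis using f mem u(2) by blast
    qed
    then show "f \<in> {f \<in> hardy2. \<forall>w\<in>hardy2.
        (\<forall>\<alpha>\<in>F. hinner (kernel_vector c \<alpha>) w = 0) \<longrightarrow> hinner w f = 0}"
      using f mem by blast
  next
    fix f assume f: "f \<in> {f \<in> hardy2. \<forall>w\<in>hardy2.
        (\<forall>\<alpha>\<in>F. hinner (kernel_vector c \<alpha>) w = 0) \<longrightarrow> hinner w f = 0}"
    have "hinner (\<lambda>z. opH u z - cnj c * u z) f = 0" if u: "u \<in> dom_L F" for u
    proof -
      have uH: "u \<in> dom_H" using u by (simp add: dom_L_def)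
      then have "(\<lambda>z. opH u z - cnj c * u z) \<in> hardy2"
        by (auto simp: dom_H_def intro: diff_hardy2 cmult_hardy2)
      then show ?thesis using f dom_L[OF uH] u by blast
    qed
    then show "f \<in> defect_space c F" using f mem by blast
  qed
qed

lemma hilbert_subspace_orthogonal_complement:
  assumes W: "W \<subseteq> hardy2"
  shows "hilbert_subspace {f \<in> hardy2. \<forall>w\<in>W. hinner w f = 0}" (is "hilbert_subspace ?V")
  unfolding hilbert_subspace_def
proof (intro conjI allI ballI impI)
  fix s :: "nat \<Rightarrow> complex \<Rightarrow> complex"
  assume s: "(\<forall>n. s n \<in> ?V) \<and>
    (\<forall>\<epsilon>>0. \<exists>N. \<forall>m\<ge>N. \<forall>n\<ge>N. hnorm (\<lambda>z. s m z - s n z) < \<epsilon>)"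
  then have "Cauchy (\<lambda>n. to_l2 (s n))" by (auto simp: Cauchy_def hnorm_diff_eq_dist)
  then obtain x where x: "(\<lambda>n. to_l2 (s n)) \<longlonglongrightarrow> x"
    using Cauchy_convergent convergent_def by blast
  obtain f where f: "f \<in> hardy2" "to_l2 f = x" by (rule to_l2_surj)
  have "hinner w f = 0" if w: "w \<in> W" for w
  proof -
    have lim: "inner y x = 0" if "\<And>n. inner y (to_l2 (s n)) = 0" for y
    proof -
      have "(\<lambda>n. inner y (to_l2 (s n))) \<longlonglongrightarrow> inner y x" by (intro tendsto_intros x)
      then show ?thesis using that by (simp add: LIMSEQ_const_iff)
    qed
    have wH: "w \<in> hardy2" and "s n \<in> hardy2" "hinner w (s n) = 0" for n
      using s w W by auto
    then have "inner (to_l2 w) (to_l2 (s n)) = 0" "inner (to_l2 (\<lambda>z. \<i> * w z)) (to_l2 (s n)) = 0"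
      for n
      using hinner_eq_0_iff[OF wH, of "s n"] by auto
    then show ?thesis
      using lim by (simp add: hinner_eq_0_iff[OF wH f(1)] f(2))
  qed
  moreover have "(\<lambda>n. hnorm (\<lambda>z. s n z - f z)) \<longlonglongrightarrow> 0"
    using x s f by (simp add: hnorm_diff_eq_dist tendsto_dist_iff[symmetric])
  ultimately show "\<exists>f\<in>?V. (\<lambda>n. hnorm (\<lambda>z. s n z - f z)) \<longlonglongrightarrow> 0" using f by blast
qed (use W in \<open>auto simp: zero_hardy2 add_hardy2 cmult_hardy2 hinner_zero_right hinner_add_right
    subset_iff hinner_cmult_right\<close>)


section \<open>The isometry\<close>

lemma fin_supp_add: "\<phi> \<in> fin_supp F \<Longrightarrow> \<psi> \<in> fin_supp F \<Longrightarrow> (\<lambda>\<zeta>. \<phi> \<zeta> + \<psi> \<zeta>) \<in> fin_supp F"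
proof -
  assume *: "\<phi> \<in> fin_supp F" "\<psi> \<in> fin_supp F"
  have "{\<zeta>. \<phi> \<zeta> + \<psi> \<zeta> \<noteq> 0} \<subseteq> {\<zeta>. \<phi> \<zeta> \<noteq> 0} \<union> {\<zeta>. \<psi> \<zeta> \<noteq> 0}" by auto
  moreover from * have "finite ({\<zeta>. \<phi> \<zeta> \<noteq> 0} \<union> {\<zeta>. \<psi> \<zeta> \<noteq> 0})"
    "{\<zeta>. \<phi> \<zeta> \<noteq> 0} \<union> {\<zeta>. \<psi> \<zeta> \<noteq> 0} \<subseteq> F" by (auto simp: fin_supp_def)
  ultimately show ?thesis unfolding fin_supp_def using finite_subset by blast
qed

lemma fin_supp_cmult: "\<phi> \<in> fin_supp F \<Longrightarrow> (\<lambda>\<zeta>. c * \<phi> \<zeta>) \<in> fin_supp F"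
  by (auto simp: fin_supp_def intro: finite_subset[of _ "{\<zeta>. \<phi> \<zeta> \<noteq> 0}"])

text \<open>
  The support of a sum can be smaller than the union of the supports; summing over a common
  finite superset gives additivity.
\<close>

lemma kernel_isometry_superset:
  assumes "finite T" "{\<zeta>. \<phi> \<zeta> \<noteq> 0} \<subseteq> T"
  shows "kernel_isometry c \<phi> = (\<lambda>z. \<Sum>\<alpha>\<in>T. \<phi> \<alpha> * kernel_vector c \<alpha> z)"
  unfolding kernel_isometry_def
  by (intro ext sum.mono_neutral_left assms) auto

lemma kernel_isometry_add:
  assumes "\<phi> \<in> fin_supp F" "\<psi> \<in> fin_supp F"
  shows "kernel_isometry c (\<lambda>\<zeta>. \<phi> \<zeta> + \<psi> \<zeta>) =
    (\<lambda>z. kernel_isometry c \<phi> z + kernel_isometry c \<psi> z)"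
proof -
  define T where "T = {\<zeta>. \<phi> \<zeta> \<noteq> 0} \<union> {\<zeta>. \<psi> \<zeta> \<noteq> 0}"
  have T: "finite T" using assms by (auto simp: T_def fin_supp_def)
  have "kernel_isometry c \<eta> = (\<lambda>z. \<Sum>\<alpha>\<in>T. \<eta> \<alpha> * kernel_vector c \<alpha> z)"
    if "\<eta> \<in> {\<phi>, \<psi>, (\<lambda>\<zeta>. \<phi> \<zeta> + \<psi> \<zeta>)}" for \<eta>
    using that by (intro kernel_isometry_superset T) (auto simp: T_def)
  then show ?thesis by (simp add: distrib_right sum.distrib)
qed

lemma kernel_isometry_cmult:
  assumes "\<phi> \<in> fin_supp F"
  shows "kernel_isometry c (\<lambda>\<zeta>. d * \<phi> \<zeta>) = (\<lambda>z. d * kernel_isometry c \<phi> z)"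
proof -
  have "kernel_isometry c (\<lambda>\<zeta>. d * \<phi> \<zeta>) =
      (\<lambda>z. \<Sum>\<alpha>\<in>{\<zeta>. \<phi> \<zeta> \<noteq> 0}. d * \<phi> \<alpha> * kernel_vector c \<alpha> z)"
    using assms by (intro kernel_isometry_superset) (auto simp: fin_supp_def)
  then show ?thesis by (simp add: kernel_isometry_def sum_distrib_left mult.assoc)
qed

lemma kernel_isometry_unit_mass:
  "kernel_isometry c (\<lambda>\<zeta>. if \<zeta> = \<alpha> then d else 0) = (\<lambda>z. d * kernel_vector c \<alpha> z)"
  by (subst kernel_isometry_superset[of "{\<alpha>}"]) auto

lemma kernel_isometry_hardy2:
  assumes "c \<in> {\<i>, -\<i>}" "\<phi> \<in> fin_supp F"
  shows "kernel_isometry c \<phi> \<in> hardy2"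
  unfolding kernel_isometry_def
  using assms by (intro sum_hardy2[OF _ zero_hardy2] kernel_vector_hardy2) (auto simp: fin_supp_def)

lemma hinner_kernel_isometry_right:
  assumes "c \<in> {\<i>, -\<i>}" "\<phi> \<in> fin_supp F" "w \<in> hardy2"
  shows "hinner w (kernel_isometry c \<phi>) =
    (\<Sum>\<alpha>\<in>{\<zeta>. \<phi> \<zeta> \<noteq> 0}. \<phi> \<alpha> * hinner w (kernel_vector c \<alpha>))"
  unfolding kernel_isometry_def
  using assms by (intro hinner_sum_right kernel_vector_hardy2) (auto simp: fin_supp_def)

lemma hinner_kernel_isometry:
  assumes c: "c \<in> {\<i>, -\<i>}" and \<phi>: "\<phi> \<in> fin_supp F" and \<psi>: "\<psi> \<in> fin_supp F"
  shows "hinner (kernel_isometry c \<phi>) (kernel_isometry c \<psi>) = kernel_inner Z_kernel \<phi> \<psi>"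
proof -
  note h = kernel_isometry_hardy2[OF c] kernel_vector_hardy2[OF c]
  have hermitian: "cnj (Z_kernel \<beta> \<alpha>) = Z_kernel \<alpha> \<beta>" for \<alpha> \<beta>
    using hinner_commute[OF h(2) h(2), of \<beta> \<alpha>] by (simp add: hinner_kernel_vector[OF c])
  have "hinner (kernel_isometry c \<phi>) (kernel_vector c \<beta>) =
      (\<Sum>\<alpha>\<in>{\<zeta>. \<phi> \<zeta> \<noteq> 0}. cnj (\<phi> \<alpha>) * Z_kernel \<alpha> \<beta>)" for \<beta>
  proof -
    have "hinner (kernel_isometry c \<phi>) (kernel_vector c \<beta>) =
        cnj (hinner (kernel_vector c \<beta>) (kernel_isometry c \<phi>))"
      by (rule hinner_commute) (rule h(2), rule h(1)[OF \<phi>])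
    also have "\<dots> = (\<Sum>\<alpha>\<in>{\<zeta>. \<phi> \<zeta> \<noteq> 0}. cnj (\<phi> \<alpha>) *
        cnj (hinner (kernel_vector c \<beta>) (kernel_vector c \<alpha>)))"
      by (simp add: hinner_kernel_isometry_right[OF c \<phi>] h)
    also have "\<dots> = (\<Sum>\<alpha>\<in>{\<zeta>. \<phi> \<zeta> \<noteq> 0}. cnj (\<phi> \<alpha>) * Z_kernel \<alpha> \<beta>)"
      by (simp only: hermitian hinner_kernel_vector[OF c])
    finally show ?thesis .
  qed
  then have "hinner (kernel_isometry c \<phi>) (kernel_isometry c \<psi>) =
      (\<Sum>\<beta>\<in>{\<zeta>. \<psi> \<zeta> \<noteq> 0}. \<Sum>\<alpha>\<in>{\<zeta>. \<phi> \<zeta> \<noteq> 0}. cnj (\<phi> \<alpha>) * \<psi> \<beta> * Z_kernel \<alpha> \<beta>)"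
    by (simp add: hinner_kernel_isometry_right[OF c \<psi>] h(1)[OF \<phi>] sum_distrib_left mult_ac)
  then show ?thesis unfolding kernel_inner_def by (subst sum.swap)
qed

lemma hinner_self:
  assumes "f \<in> hardy2"
  shows "hinner f f = complex_of_real ((norm (to_l2 f))\<^sup>2)"
  using hinner_commute[OF assms assms] inner_to_l2[OF assms assms]
  by (simp add: complex_eq_iff power2_norm_eq_inner)

text \<open>
  The kernel is a Gram matrix, so its quadratic form is a squared norm. Either value of \<open>c\<close> serves.
\<close>

lemma positive_definite_Z_kernel: "positive_definite_kernel F Z_kernel"
  unfolding positive_definite_kernel_def
proof
  fix \<phi> assume \<phi>: "\<phi> \<in> fin_supp F"
  have "kernel_inner Z_kernel \<phi> \<phi> = hinner (kernel_isometry \<i> \<phi>) (kernel_isometry \<i> \<phi>)"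
    using hinner_kernel_isometry[OF _ \<phi> \<phi>, of \<i>] by simp
  then show "Im (kernel_inner Z_kernel \<phi> \<phi>) = 0 \<and> 0 \<le> Re (kernel_inner Z_kernel \<phi> \<phi>)"
    using kernel_isometry_hardy2[OF _ \<phi>, of \<i>] by (simp add: hinner_self)
qed

text \<open>
  Let \<open>S\<close> be the linear span of the kernel vectors over \<open>F\<close>. A vector \<open>w\<close> that is orthogonal to \<open>S\<close> is
  orthogonal to the defect space, as this is the double complement, so every element of the defect
  space lies in the closure of \<open>S\<close>.
\<close>

lemma kernel_isometry_dense:
  assumes c: "c \<in> {\<i>, -\<i>}" and F: "F \<subseteq> sphere 0 1"
  shows "hdense (kernel_isometry c ` fin_supp F) (defect_space c F)"
  unfolding hdense_def
proof (intro ballI allI impI)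
  fix f and \<epsilon> :: real assume "f \<in> defect_space c F" and \<epsilon>: "\<epsilon> > 0"
  then have f: "f \<in> hardy2"
    and orth: "\<And>w. w \<in> hardy2 \<Longrightarrow> (\<forall>\<alpha>\<in>F. hinner (kernel_vector c \<alpha>) w = 0) \<Longrightarrow> hinner w f = 0"
    by (auto simp: defect_space_eq_double_complement[OF c F])
  note J = kernel_isometry_hardy2[OF c]
  define S where "S = to_l2 ` kernel_isometry c ` fin_supp F"
  have "to_l2 f \<in> closure S"
  proof (rule double_orthogonal_complement_subset_closure)
    have "0 = to_l2 (kernel_isometry c (\<lambda>_. 0))"
      using to_l2_scaleR[OF zero_hardy2, of 0] by (simp add: kernel_isometry_def)
    moreover have "(\<lambda>_. 0) \<in> fin_supp F" by (simp add: fin_supp_def)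
    ultimately have "0 \<in> S" unfolding S_def by blast
    moreover have "x + y \<in> S" if "x \<in> S" "y \<in> S" for x y
      using that by (auto simp: S_def to_l2_add[symmetric] J kernel_isometry_add[symmetric]
          intro!: imageI fin_supp_add)
    moreover have "r *\<^sub>R x \<in> S" if "x \<in> S" for x r
      using that by (auto simp: S_def to_l2_scaleR[symmetric] J kernel_isometry_cmult[symmetric]
          intro!: imageI fin_supp_cmult)
    ultimately show "subspace S" by (auto simp: subspace_def)
    fix x assume x: "\<And>s. s \<in> S \<Longrightarrow> inner s x = 0"
    obtain w where w: "w \<in> hardy2" "to_l2 w = x" by (rule to_l2_surj)
    have "hinner (kernel_vector c \<alpha>) w = 0" if \<alpha>: "\<alpha> \<in> F" for \<alpha>
    proof -
      have "to_l2 (\<lambda>z. d * kernel_vector c \<alpha> z) \<in> S" for d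
        unfolding S_def kernel_isometry_unit_mass[symmetric]
        using \<alpha> by (intro imageI) (auto simp: fin_supp_def)
      \<comment> \<open>The multiples \<open>d = 1\<close> and \<open>d = \<i>\<close> account for the real and the imaginary part.\<close>
      from this[of 1] this[of \<i>] show ?thesis
        by (simp add: hinner_eq_0_iff kernel_vector_hardy2[OF c] w x)
    qed
    then have "hinner w f = 0" using orth w by blast
    then show "inner (to_l2 f) x = 0"
      using inner_to_l2[OF w(1) f] w(2) by (simp add: inner_commute)
  qed
  then obtain \<phi> where \<phi>: "\<phi> \<in> fin_supp F" "dist (to_l2 (kernel_isometry c \<phi>)) (to_l2 f) < \<epsilon>"
    using \<epsilon> unfolding closure_approachable S_def by blast
  then have "hnorm (\<lambda>z. f z - kernel_isometry c \<phi> z) < \<epsilon>"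
    by (simp add: hnorm_diff_eq_dist f J dist_commute)
  then show "\<exists>g\<in>kernel_isometry c ` fin_supp F. hnorm (\<lambda>z. f z - g z) < \<epsilon>" using \<phi>(1) by blast
qed

lemma kernel_isometry_in_defect_space:
  assumes c: "c \<in> {\<i>, -\<i>}" and F: "F \<subseteq> sphere 0 1" and \<phi>: "\<phi> \<in> fin_supp F"
  shows "kernel_isometry c \<phi> \<in> defect_space c F"
proof -
  have "hinner w (kernel_isometry c \<phi>) = 0"
    if w: "w \<in> hardy2" "\<forall>\<alpha>\<in>F. hinner (kernel_vector c \<alpha>) w = 0" for w
  proof -
    have "hinner w (kernel_vector c \<alpha>) = 0" if "\<alpha> \<in> F" for \<alpha>
      using hinner_commute[OF kernel_vector_hardy2[OF c] w(1)] w(2) that by simp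
    then show ?thesis
      using \<phi> unfolding hinner_kernel_isometry_right[OF c \<phi> w(1)]
      by (intro sum.neutral) (auto simp: fin_supp_def)
  qed
  then show ?thesis
    using kernel_isometry_hardy2[OF c \<phi>] by (simp add: defect_space_eq_double_complement[OF c F])
qed

lemma hilbert_subspace_defect_space:
  assumes "c \<in> {\<i>, -\<i>}" "F \<subseteq> sphere 0 1"
  shows "hilbert_subspace (defect_space c F)"
proof -
  have "defect_space c F =
    {f \<in> hardy2. \<forall>w\<in>{w \<in> hardy2. \<forall>\<alpha>\<in>F. hinner (kernel_vector c \<alpha>) w = 0}. hinner w f = 0}"
    unfolding defect_space_eq_double_complement[OF assms] by blast
  also have "hilbert_subspace \<dots>" by (rule hilbert_subspace_orthogonal_complement) blast
  finally show ?thesis .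
qed

theorem theorem6p18:
  fixes F :: "complex set"
  assumes "F \<subseteq> sphere 0 1" and "closed F" and "zero_measure F"
  shows "\<forall>c\<in>{\<i>, -\<i>}.
           RKHS_completion F Z_kernel (defect_space c F) (kernel_isometry c)
         \<and> (\<forall>\<alpha>\<in>F. \<forall>u\<in>dom_H.
              (u \<longlongrightarrow> hinner (kernel_vector c \<alpha>) (\<lambda>z. opH u z - cnj c * u z))
                (at \<alpha> within ball 0 1))"
proof
  fix c assume c: "c \<in> {\<i>, -\<i>}"
  have "RKHS_completion F Z_kernel (defect_space c F) (kernel_isometry c)"
    unfolding RKHS_completion_def
    using positive_definite_Z_kernel hilbert_subspace_defect_space[OF c assms(1)]
      kernel_isometry_in_defect_space[OF c assms(1)] kernel_isometry_add[of _ F]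
      kernel_isometry_cmult[of _ F] hinner_kernel_isometry[OF c]
      kernel_isometry_dense[OF c assms(1)]
    by blast
  then show "RKHS_completion F Z_kernel (defect_space c F) (kernel_isometry c) \<and>
      (\<forall>\<alpha>\<in>F. \<forall>u\<in>dom_H. (u \<longlongrightarrow> hinner (kernel_vector c \<alpha>) (\<lambda>z. opH u z - cnj c * u z))
        (at \<alpha> within ball 0 1))"
    using evaluation_at_boundary[OF c] assms(1) by blast
qed

end
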